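(* Let $n \geq 1$, $G := \mathbb{F}_2^n$, and let $A \subset G$ have density $\alpha := |A|/|G| > 1/2 - \epsilon$, where $\epsilon \in (0, 1/(2^9\sqrt{n})]$. Then $A+A$ contains a (linear) subspace of $G$ of co-dimension $1$.
   Context: $A+A := \{a+a' : a,a' \in A\}$. *)

theory Defs
  imports "HOL-Analysis.Analysis" "HOL-Library.Z2" "HOL-Library.Set_Algebras"
begin

text \<open>
  The group \<open>G\<close> is \<^typ>\<open>bit ^ 'n\<close>, with the library's two-element field \<^typ>\<open>bit\<close> as scalars and
  \<open>n = CARD('n)\<close>, so that \<open>n \<ge> 1\<close> holds automatically. The sumset is the set addition of
  \<open>Set_Algebras\<close>. Linear subspaces and dimension are those of the locale interpretation \<open>vec\<close>
  (vectors over an arbitrary field); the unqualified \<open>subspace\<close> and \<open>dim\<close> would refer to real scalars.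
\<close>

end

theory Submission
  imports Defs
begin

text \<open>
  Let \<open>S\<close> be the complement of \<open>A + A\<close>, so that \<open>A\<close> and \<open>A + s\<close> are disjoint for \<open>s \<in> S\<close>.
  Fix \<open>s \<in> S\<close> and let \<open>W\<close> be the span of \<open>s + S\<close>. If \<open>s \<notin> W\<close>, a hyperplane that contains \<open>W\<close> but
  not \<open>s\<close> avoids \<open>S\<close>. Otherwise \<open>s = \<Sum>B\<close> for some \<open>B \<subseteq> s + S\<close> with at most \<open>n\<close> elements. By
  averaging, some translate \<open>g\<close> makes \<open>C = {y \<subseteq> B. g + \<Sum>y \<in> A}\<close> have density
  greater than \<open>1/2 - \<epsilon>\<close> in the cube of subsets of \<open>B\<close>. Since \<open>\<Sum>B = s\<close>, the family of complements of
  members of \<open>C\<close> is \<open>{y \<subseteq> B. g + s + \<Sum>y \<in> A}\<close>. It is as large as \<open>C\<close>, and it is disjoint from \<open>C\<close> and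
  from the neighbours of \<open>C\<close>, because \<open>s\<close> and all \<open>s + b\<close> with \<open>b \<in> B\<close> lie in \<open>S\<close>. Hence \<open>C\<close> has density
  about \<open>1/2\<close> and vertex boundary of density less than \<open>2 \<epsilon>\<close>, which contradicts an isoperimetric
  inequality of Talagrand type.
\<close>

section \<open>An isoperimetric inequality in the cube\<close>

text \<open>Points of the cube are subsets of \<open>I\<close>, and \<open>sym_diff x {i}\<close>
  flips coordinate \<open>i\<close>. For \<open>x\<close> in \<open>K\<close> this counts the edges
  at \<open>x\<close> that leave \<open>K\<close>, as in Talagrand's inequality.\<close>

definition sensitivity :: "'a set \<Rightarrow> 'a set set \<Rightarrow> 'a set \<Rightarrow> nat" where
  "sensitivity I K x = card {i \<in> I. sym_diff x {i} \<notin> K}"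

text \<open>With \<open>J = a * (1 - a)\<close> and \<open>t = a - b\<close> the left side equals
  \<open>J + t^2 / 2 + b * (1 - b)\<close>. So it is enough that
  \<open>(J + t^2 / 2)^2 \<le> J^2 + t^2\<close>, which follows from
  \<open>J + t^2 / 4 \<le> 1\<close>. In the induction, \<open>a\<close> and \<open>b\<close> are
  the densities of the two sections.\<close>

lemma two_point_inequality:
  fixes a b u v :: real
  assumes "0 \<le> b" "b \<le> a" "a \<le> 1" and u: "a * (1 - a) \<le> u" and v: "b * (1 - b) \<le> v"
  shows "2 * ((a + b) / 2 * (1 - (a + b) / 2)) \<le> sqrt (u\<^sup>2 + (a - b)\<^sup>2) + v"
proof -
  define J t where "J = a * (1 - a)" and "t = a - b"
  have J: "0 \<le> J" "J \<le> 1 / 4"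
    using assms zero_le_power2[of "a - 1 / 2"]
    by (simp_all add: J_def power2_eq_square algebra_simps mult_left_le)
  have t: "0 \<le> t" "t \<le> 1" using assms by (auto simp: t_def)
  have "t\<^sup>2 \<le> 1" using t by (simp add: power_le_one)
  then have "J + t\<^sup>2 / 4 \<le> 1" using J by simp
  then have "t\<^sup>2 * (J + t\<^sup>2 / 4) \<le> t\<^sup>2 * 1" by (intro mult_left_mono) auto
  then have "(J + t\<^sup>2 / 2)\<^sup>2 \<le> J\<^sup>2 + t\<^sup>2"
    by (simp add: power2_eq_square algebra_simps)
  also have "\<dots> \<le> u\<^sup>2 + t\<^sup>2" using u J by (simp add: J_def power_mono)
  finally have "J + t\<^sup>2 / 2 \<le> sqrt (u\<^sup>2 + t\<^sup>2)" by (rule real_le_rsqrt)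
  moreover have "2 * ((a + b) / 2 * (1 - (a + b) / 2)) = J + t\<^sup>2 / 2 + b * (1 - b)"
    by (simp add: J_def t_def power2_eq_square field_simps)
  ultimately show ?thesis using v by (simp add: t_def)
qed

text \<open>This is the triangle inequality for the complex numbers with real part
  \<open>sqrt (f x)\<close> and imaginary part \<open>g x\<close>; since \<open>g x\<close> is 0 or
  1, it equals its square.\<close>

lemma sum_sqrt_ge:
  fixes f g :: "'a \<Rightarrow> real"
  assumes "\<And>x. x \<in> X \<Longrightarrow> 0 \<le> f x" "\<And>x. x \<in> X \<Longrightarrow> g x \<in> {0, 1}"
  shows "sqrt ((\<Sum>x\<in>X. sqrt (f x))\<^sup>2 + (\<Sum>x\<in>X. g x)\<^sup>2) \<le> (\<Sum>x\<in>X. sqrt (f x + g x))"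
proof -
  have "cmod (\<Sum>x\<in>X. Complex (sqrt (f x)) (g x)) \<le> (\<Sum>x\<in>X. cmod (Complex (sqrt (f x)) (g x)))"
    by (rule norm_sum)
  moreover have "(\<Sum>x\<in>X. Complex (sqrt (f x)) (g x)) = Complex (\<Sum>x\<in>X. sqrt (f x)) (\<Sum>x\<in>X. g x)"
    by (simp add: complex_eq_iff)
  moreover have "(\<Sum>x\<in>X. cmod (Complex (sqrt (f x)) (g x))) = (\<Sum>x\<in>X. sqrt (f x + g x))"
    using assms by (intro sum.cong refl) (fastforce simp: cmod_def)
  ultimately show ?thesis by (simp add: cmod_def)
qed

text \<open>
  \<open>K\<^sub>0\<close> and \<open>K\<^sub>1\<close> are the two sections of a family in one direction. It suffices to count the edges
  that leave the larger section \<open>K\<^sub>0\<close> in that direction.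
\<close>

lemma isoperimetry_step:
  fixes I :: "'a set" and K\<^sub>0 K\<^sub>1 :: "'a set set"
  defines "N \<equiv> (2::real) ^ card I"
  assumes fin: "finite I"
    and IH: "\<And>K :: 'a set set. card (Pow I \<inter> K) / N * (1 - card (Pow I \<inter> K) / N)
               \<le> (\<Sum>x\<in>Pow I \<inter> K. sqrt (sensitivity I K x)) / N"
    and le: "card (Pow I \<inter> K\<^sub>1) \<le> card (Pow I \<inter> K\<^sub>0)"
  shows "2 * ((card (Pow I \<inter> K\<^sub>0) + card (Pow I \<inter> K\<^sub>1)) / (2 * N)
              * (1 - (card (Pow I \<inter> K\<^sub>0) + card (Pow I \<inter> K\<^sub>1)) / (2 * N)))
     \<le> (\<Sum>x\<in>Pow I \<inter> K\<^sub>0. sqrt (sensitivity I K\<^sub>0 x + of_bool (x \<notin> K\<^sub>1))) / N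
       + (\<Sum>x\<in>Pow I \<inter> K\<^sub>1. sqrt (sensitivity I K\<^sub>1 x)) / N"
proof -
  have N: "N > 0" by (simp add: N_def)
  define a b where "a = card (Pow I \<inter> K\<^sub>0) / N" and "b = card (Pow I \<inter> K\<^sub>1) / N"
  define u where "u = (\<Sum>x\<in>Pow I \<inter> K\<^sub>0. sqrt (sensitivity I K\<^sub>0 x)) / N"
  define v where "v = (\<Sum>x\<in>Pow I \<inter> K\<^sub>1. sqrt (sensitivity I K\<^sub>1 x)) / N"
  define D where "D = (\<Sum>x\<in>Pow I \<inter> K\<^sub>0. of_bool (x \<notin> K\<^sub>1) :: real)"
  have "card (Pow I \<inter> K\<^sub>0) \<le> card (Pow I)" using fin by (intro card_mono) auto
  then have "real (card (Pow I \<inter> K\<^sub>0)) \<le> N"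
    using fin by (simp add: card_Pow N_def flip: of_nat_le_iff)
  then have ab: "0 \<le> b" "b \<le> a" "a \<le> 1"
    using N le by (auto simp: a_def b_def divide_right_mono)
  \<comment> \<open>The surplus of the larger section bounds from below the number \<open>D\<close>
    of edges leaving it in the new direction.\<close>
  have "card (Pow I \<inter> K\<^sub>0) - card (Pow I \<inter> K\<^sub>1) \<le> card (Pow I \<inter> K\<^sub>0 - Pow I \<inter> K\<^sub>1)"
    using fin by (intro diff_card_le_card_Diff) auto
  also have "Pow I \<inter> K\<^sub>0 - Pow I \<inter> K\<^sub>1 = Pow I \<inter> K\<^sub>0 \<inter> {x. x \<notin> K\<^sub>1}" by auto
  finally have "real (card (Pow I \<inter> K\<^sub>0)) - real (card (Pow I \<inter> K\<^sub>1)) \<le> D"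
    using le fin by (simp add: D_def sum_of_bool_eq of_nat_diff flip: of_nat_le_iff)
  then have "a - b \<le> D / N"
    using N by (simp add: a_def b_def divide_right_mono flip: diff_divide_distrib)
  then have "(a - b)\<^sup>2 \<le> (D / N)\<^sup>2" using ab by (intro power_mono) auto
  then have "sqrt (u\<^sup>2 + (a - b)\<^sup>2) \<le> sqrt (u\<^sup>2 + (D / N)\<^sup>2)" by simp
  also have "\<dots> = sqrt (((\<Sum>x\<in>Pow I \<inter> K\<^sub>0. sqrt (sensitivity I K\<^sub>0 x))\<^sup>2 + D\<^sup>2) / N\<^sup>2)"
    by (simp add: u_def power_divide add_divide_distrib)
  also have "\<dots> = sqrt ((\<Sum>x\<in>Pow I \<inter> K\<^sub>0. sqrt (sensitivity I K\<^sub>0 x))\<^sup>2 + D\<^sup>2) / N"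
    using N by (simp add: real_sqrt_divide)
  also have "\<dots> \<le> (\<Sum>x\<in>Pow I \<inter> K\<^sub>0. sqrt (sensitivity I K\<^sub>0 x + of_bool (x \<notin> K\<^sub>1))) / N"
    unfolding D_def of_nat_add of_nat_of_bool using N
    by (intro divide_right_mono sum_sqrt_ge) auto
  finally have 1: "sqrt (u\<^sup>2 + (a - b)\<^sup>2) \<le> \<dots>" .
  have "2 * ((a + b) / 2 * (1 - (a + b) / 2)) \<le> sqrt (u\<^sup>2 + (a - b)\<^sup>2) + v"
    using ab IH[of K\<^sub>0] IH[of K\<^sub>1]
    by (intro two_point_inequality) (auto simp: a_def b_def u_def v_def)
  moreover have "(a + b) / 2 = (card (Pow I \<inter> K\<^sub>0) + card (Pow I \<inter> K\<^sub>1)) / (2 * N)"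
    by (simp add: a_def b_def add_divide_distrib)
  ultimately show ?thesis using 1 by (simp add: v_def)
qed

lemma sum_Pow_insert_Int:
  fixes f :: "'a set \<Rightarrow> 'b::comm_monoid_add"
  assumes "finite I" "j \<notin> I"
  shows "(\<Sum>x\<in>Pow (insert j I) \<inter> K. f x) =
         (\<Sum>x\<in>Pow I \<inter> K. f x) + (\<Sum>x\<in>Pow I \<inter> {x. insert j x \<in> K}. f (insert j x))"
proof -
  have "Pow (insert j I) \<inter> K = (Pow I \<inter> K) \<union> insert j ` (Pow I \<inter> {x. insert j x \<in> K})"
    by (auto simp: Pow_insert)
  moreover have "(Pow I \<inter> K) \<inter> insert j ` (Pow I \<inter> {x. insert j x \<in> K}) = {}"
    using assms by auto
  moreover have "inj_on (insert j) (Pow I \<inter> {x. insert j x \<in> K})"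
    using assms by (intro inj_onI) (metis IntD1 PowD insert_ident subsetD)
  ultimately show ?thesis
    using assms by (simp add: sum.union_disjoint sum.reindex)
qed

lemma sensitivity_insert:
  assumes "finite I" "j \<notin> I" "x \<subseteq> I"
  shows "sensitivity (insert j I) K x = sensitivity I K x + of_bool (insert j x \<notin> K)"
    and "sensitivity (insert j I) K (insert j x)
       = sensitivity I {y. insert j y \<in> K} x + of_bool (x \<notin> K)"
proof -
  have card: "card {i \<in> insert j I. P i} = card {i \<in> I. P i} + of_bool (P j)" for P
  proof -
    have "{i \<in> insert j I. P i} = (if P j then insert j {i \<in> I. P i} else {i \<in> I. P i})"
      by auto
    then show ?thesis using assms(1,2) by simp
  qed
  have "sym_diff x {j} = insert j x" using assms by auto
  then show "sensitivity (insert j I) K x = sensitivity I K x + of_bool (insert j x \<notin> K)"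
    by (simp only: sensitivity_def card)
  have "sym_diff (insert j x) {i} = insert j (sym_diff x {i})" if "i \<in> I" for i
    using that assms by auto
  then have "{i \<in> I. sym_diff (insert j x) {i} \<notin> K} = {i \<in> I. sym_diff x {i} \<notin> {y. insert j y \<in> K}}"
    by (intro Collect_cong) (metis mem_Collect_eq)
  moreover have "sym_diff (insert j x) {j} = x" using assms by auto
  ultimately show "sensitivity (insert j I) K (insert j x)
       = sensitivity I {y. insert j y \<in> K} x + of_bool (x \<notin> K)"
    by (simp only: sensitivity_def card)
qed

text \<open>Induction on the dimension, splitting the cube along the new coordinate \<open>j\<close>
  into two sections. In dimension 0 the density is 0 or 1, so both sides vanish.\<close>

lemma cube_isoperimetry:
  fixes I :: "'a set" and K :: "'a set set"
  assumes "finite I"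
  shows "card (Pow I \<inter> K) / 2 ^ card I * (1 - card (Pow I \<inter> K) / 2 ^ card I)
         \<le> (\<Sum>x\<in>Pow I \<inter> K. sqrt (sensitivity I K x)) / 2 ^ card I"
  using assms
proof (induction I arbitrary: K rule: finite_induct)
  case empty
  show ?case by (cases "{} \<in> K") (auto simp: sensitivity_def)
next
  case (insert j I)
  define N where "N = (2::real) ^ card I"
  have N: "N > 0" by (simp add: N_def)
  define L where "L = {x. insert j x \<in> K}"
  define p q where "p = card (Pow I \<inter> K)" and "q = card (Pow I \<inter> L)"
  have card: "card (Pow (insert j I) \<inter> K) = p + q"
    using sum_Pow_insert_Int[OF insert.hyps(1,2), of "\<lambda>_. 1::nat" K]
    by (simp add: p_def q_def L_def)
  have "(\<Sum>x\<in>Pow (insert j I) \<inter> K. sqrt (sensitivity (insert j I) K x)) =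
      (\<Sum>x\<in>Pow I \<inter> K. sqrt (sensitivity (insert j I) K x)) +
      (\<Sum>x\<in>Pow I \<inter> L. sqrt (sensitivity (insert j I) K (insert j x)))"
    using sum_Pow_insert_Int[OF insert.hyps(1,2), of "\<lambda>x. sqrt (sensitivity (insert j I) K x)" K]
    by (simp add: L_def)
  also have "(\<Sum>x\<in>Pow I \<inter> K. sqrt (sensitivity (insert j I) K x))
      = (\<Sum>x\<in>Pow I \<inter> K. sqrt (sensitivity I K x + of_bool (x \<notin> L)))"
    using insert.hyps by (intro sum.cong) (auto simp: sensitivity_insert L_def)
  also have "(\<Sum>x\<in>Pow I \<inter> L. sqrt (sensitivity (insert j I) K (insert j x)))
      = (\<Sum>x\<in>Pow I \<inter> L. sqrt (sensitivity I L x + of_bool (x \<notin> K)))"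
    using insert.hyps by (intro sum.cong) (auto simp: sensitivity_insert L_def)
  finally have sum: "(\<Sum>x\<in>Pow (insert j I) \<inter> K. sqrt (sensitivity (insert j I) K x)) =
      (\<Sum>x\<in>Pow I \<inter> K. sqrt (sensitivity I K x + of_bool (x \<notin> L))) +
      (\<Sum>x\<in>Pow I \<inter> L. sqrt (sensitivity I L x + of_bool (x \<notin> K)))" (is "?S = ?S\<^sub>0 + ?S\<^sub>1") .
  \<comment> \<open>Edges in direction \<open>j\<close> are kept for the larger section and
    discarded for the smaller one; the two cases below swap the roles of \<open>K\<close> and
    \<open>L\<close>.\<close>
  have drop: "(\<Sum>x\<in>Pow I \<inter> X. sqrt (sensitivity I X x)) / N
      \<le> (\<Sum>x\<in>Pow I \<inter> X. sqrt (sensitivity I X x + of_bool (x \<notin> Y))) / N" for X Y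
    using N by (intro divide_right_mono sum_mono) auto
  have "2 * (real (p + q) / (2 * N) * (1 - real (p + q) / (2 * N))) \<le> ?S\<^sub>0 / N + ?S\<^sub>1 / N"
  proof (cases "q \<le> p")
    case True
    then show ?thesis
      using isoperimetry_step[OF insert.hyps(1) insert.IH, of L K] drop[of L K]
      by (simp add: p_def q_def flip: N_def)
  next
    case False
    then show ?thesis
      using isoperimetry_step[OF insert.hyps(1) insert.IH, of K L] drop[of K L]
      by (simp add: p_def q_def add.commute flip: N_def)
  qed
  then have "real (p + q) / (2 * N) * (1 - real (p + q) / (2 * N)) \<le> ?S / (2 * N)"
    unfolding sum by (simp add: add_divide_distrib)
  then show ?case
    using insert.hyps card by (simp add: N_def)
qed

text \<open>\<open>cube_isoperimetry\<close> is applied to the complement of \<open>C\<close>.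
  Points of \<open>F\<close> have no neighbour in \<open>C\<close>, hence sensitivity 0 there; only
  points outside both families contribute, each at most \<open>sqrt (card I)\<close>.\<close>

corollary vertex_boundary_bound:
  fixes I :: "'a set" and C F :: "'a set set"
  assumes fin: "finite I" and disj: "C \<inter> F = {}"
    and nbr: "\<And>x i. x \<in> Pow I \<inter> C \<Longrightarrow> i \<in> I \<Longrightarrow> sym_diff x {i} \<notin> F"
  defines "N \<equiv> (2::real) ^ card I"
  shows "card (Pow I \<inter> C) / N * (1 - card (Pow I \<inter> C) / N)
         \<le> sqrt (card I) * (1 - card (Pow I \<inter> C) / N - card (Pow I \<inter> F) / N)"
proof -
  have N: "N > 0" by (simp add: N_def)
  define c f where "c = card (Pow I \<inter> C)" and "f = card (Pow I \<inter> F)"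
  have cardN: "real (card (Pow I)) = N" using fin by (simp add: N_def card_Pow)
  have "card (Pow I) = c + card (Pow I \<inter> - C)"
    unfolding c_def Diff_eq[symmetric] using fin by (intro card_Int_Diff) simp
  then have K: "real (card (Pow I \<inter> - C)) = N - c" using cardN by simp
  have "card (Pow I \<inter> - C) = card (Pow I \<inter> - C \<inter> F) + card (Pow I \<inter> - C - F)"
    using fin by (intro card_Int_Diff) simp
  also have "Pow I \<inter> - C \<inter> F = Pow I \<inter> F" using disj by auto
  finally have B: "real (card (Pow I \<inter> - C - F)) = N - c - f" using K by (simp add: f_def)
  have zero: "sensitivity I (- C) x = 0" if x: "x \<in> Pow I" "x \<in> F" for x
  proof -
    have "sym_diff x {i} \<notin> C" if i: "i \<in> I" for i
    proof
      assume "sym_diff x {i} \<in> C"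
      then have "sym_diff (sym_diff x {i}) {i} \<notin> F"
        using x i by (intro nbr) auto
      moreover have "sym_diff (sym_diff x {i}) {i} = x" by auto
      ultimately show False using x by simp
    qed
    then have "{i \<in> I. sym_diff x {i} \<notin> - C} = {}" by blast
    then show ?thesis unfolding sensitivity_def by (simp only: card.empty)
  qed
  have "(\<Sum>x\<in>Pow I \<inter> - C. sqrt (sensitivity I (- C) x))
      = (\<Sum>x\<in>Pow I \<inter> - C - F. sqrt (sensitivity I (- C) x))"
    using fin zero by (intro sum.mono_neutral_right) auto
  also have "\<dots> \<le> (\<Sum>x\<in>Pow I \<inter> - C - F. sqrt (card I))"
    using fin unfolding sensitivity_def
    by (intro sum_mono) (auto intro!: card_mono)
  also have "\<dots> = (N - c - f) * sqrt (card I)" using B by simp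
  finally have "(\<Sum>x\<in>Pow I \<inter> - C. sqrt (sensitivity I (- C) x)) / N
      \<le> (N - c - f) * sqrt (card I) / N"
    using N by (intro divide_right_mono) auto
  with cube_isoperimetry[OF fin, of "- C"]
  have "(N - c) / N * (1 - (N - c) / N) \<le> (N - c - f) * sqrt (card I) / N"
    unfolding K N_def[symmetric] by (rule order_trans)
  then show ?thesis
    using N by (simp add: c_def f_def diff_divide_distrib add_divide_distrib algebra_simps)
qed

section \<open>Vectors over the two-element field\<close>

text \<open>A basis of \<open>W\<close> together with \<open>v\<close> extends to a basis of the
  whole space; dropping \<open>v\<close> from it leaves a basis of the required hyperplane.\<close>

lemma hyperplane_avoiding_vector:
  fixes W :: "('a::field ^ 'n) set"
  assumes "vec.subspace W" "v \<notin> W"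
  obtains V where "vec.subspace V" "vec.dim V + 1 = vec.dim (UNIV :: ('a ^ 'n) set)" "W \<subseteq> V" "v \<notin> V"
proof -
  obtain B where B: "B \<subseteq> W" "vec.independent B" "W \<subseteq> vec.span B"
    by (rule vec.basis_exists)
  then have "vec.span B = W" using assms(1) by (simp add: vec.span_subspace)
  then have "vec.independent (insert v B)"
    using B assms(2) by (simp add: vec.independent_insertI)
  then obtain B' where B': "insert v B \<subseteq> B'" "vec.independent B'" "UNIV \<subseteq> vec.span B'"
    using vec.maximal_independent_subset_extend[of "insert v B" UNIV] by (metis subset_UNIV)
  have fin: "finite B'" using B' by (simp add: vec.finiteI_independent)
  have indep: "vec.independent (B' - {v})"
    using B'(2) by (rule vec.independent_mono) auto
  show ?thesis
  proof
    show "vec.subspace (vec.span (B' - {v}))" by simp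
    have "card B' = vec.dim (UNIV :: ('a ^ 'n) set)"
      using B' by (intro vec.basis_card_eq_dim) auto
    moreover have "card (B' - {v}) + 1 = card B'"
      using B'(1) card_Suc_Diff1[OF fin, of v] by simp
    ultimately show "vec.dim (vec.span (B' - {v})) + 1 = vec.dim (UNIV :: ('a ^ 'n) set)"
      using indep by (simp add: vec.dim_eq_card_independent)
    have "B \<subseteq> B' - {v}" using B' B(1) assms(2) by auto
    then show "W \<subseteq> vec.span (B' - {v})"
      using B(3) vec.span_mono order_trans by metis
    show "v \<notin> vec.span (B' - {v})"
      using B'(1,2) by (meson insert_subset vec.dependent_def)
  qed
qed

text \<open>Makes \<open>bit ^ 'n\<close> a finite type, as the averaging in
  \<open>exists_dense_translate\<close> requires.\<close>

instance bit :: finite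
proof
  have "(UNIV :: bit set) = {0, 1}" by auto
  then show "finite (UNIV :: bit set)" by (metis finite.emptyI finite.insertI)
qed

lemma bit_vec_add_self [simp]: "x + x = (0 :: bit ^ 'n)"
  by (simp add: vec_eq_iff)

lemma bit_vec_add_self_left [simp]: "x + (x + y) = (y :: bit ^ 'n)"
  by (simp flip: add.assoc)

text \<open>Coefficients are 0 or 1, so a linear combination is a subset sum; choosing a basis
  inside \<open>D\<close> first bounds the number of summands.\<close>

lemma bit_vec_span_imp_sum:
  fixes v :: "bit ^ 'n"
  assumes "v \<in> vec.span D"
  obtains B where "B \<subseteq> D" "finite B" "card B \<le> CARD('n)" "v = \<Sum>B"
proof -
  obtain B where B: "B \<subseteq> D" "vec.independent B" "D \<subseteq> vec.span B"
    by (rule vec.basis_exists)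
  have fin: "finite B" and card: "card B \<le> CARD('n)"
    using vec.finiteI_independent[OF B(2)] vec.independent_card_le_dim[OF subset_UNIV B(2)]
    unfolding vec_dim_card by simp_all
  have "v \<in> vec.span B" using assms B by (metis subsetD vec.span_minimal vec.subspace_span)
  then obtain u where u: "v = (\<Sum>b\<in>B. u b *s b)" using vec.span_finite[OF fin] by auto
  show ?thesis
  proof
    show "{b \<in> B. u b = 1} \<subseteq> D" using B by auto
    show "finite {b \<in> B. u b = 1}" using fin by simp
    show "card {b \<in> B. u b = 1} \<le> CARD('n)"
      using card card_mono[OF fin, of "{b \<in> B. u b = 1}"] by simp
    have "u b *s b = (if u b = 1 then b else 0)" for b by (cases "u b") auto
    then show "v = \<Sum>{b \<in> B. u b = 1}"
      using u fin by (simp add: sum.inter_filter)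
  qed
qed

text \<open>In characteristic two, removing \<open>b\<close> changes the sum just as adding it does.
  Hence flipping a coordinate of the cube translates the subset sum by \<open>b\<close>.\<close>

lemma bit_vec_sum_sym_diff:
  fixes X :: "(bit ^ 'n) set"
  assumes "finite X"
  shows "\<Sum>(sym_diff X {b}) = \<Sum>X + b"
proof (cases "b \<in> X")
  case True
  then have "sym_diff X {b} = X - {b}" "\<Sum>X = b + \<Sum>(X - {b})"
    using assms by (auto simp: sum.remove)
  then show ?thesis by (simp add: add.commute)
next
  case False
  then have "sym_diff X {b} = insert b X" by auto
  then show ?thesis using assms False by (simp add: add.commute)
qed

text \<open>Double counting of the pairs \<open>(g, x)\<close> with \<open>g + f x \<in> A\<close>:
  each \<open>x\<close> lies in exactly \<open>card A\<close> of them, so some \<open>g\<close>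
  reaches the average.\<close>

lemma exists_dense_translate:
  fixes A :: "'b::{ab_group_add, finite} set" and f :: "'a \<Rightarrow> 'b"
  assumes "finite X" "X \<noteq> {}" and "\<delta> < real (card A) / real (CARD('b))"
  obtains g where "\<delta> * card X < card {x \<in> X. g + f x \<in> A}"
proof -
  have "card {g. g + f x \<in> A} = card A" for x
  proof -
    have "{g. g + f x \<in> A} = (\<lambda>a. a - f x) ` A"
      by (auto simp: image_iff) (metis add_diff_cancel)
    then show ?thesis by (simp add: card_image)
  qed
  then have "card X * card A = (\<Sum>x\<in>X. card {g. g + f x \<in> A})" by simp
  also have "\<dots> = (\<Sum>x\<in>X. \<Sum>g\<in>UNIV. of_bool (g + f x \<in> A))" by (simp add: sum_of_bool_eq)
  also have "\<dots> = (\<Sum>g\<in>UNIV. \<Sum>x\<in>X. of_bool (g + f x \<in> A))" by (rule sum.swap)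
  also have "\<dots> = (\<Sum>g\<in>UNIV. card {x \<in> X. g + f x \<in> A})"
    using assms(1) by (simp add: sum_of_bool_eq Int_def conj_commute)
  finally have eq: "card X * card A = \<dots>" .
  show ?thesis
  proof (rule ccontr)
    assume "\<not> thesis"
    then have "(\<Sum>g\<in>UNIV. real (card {x \<in> X. g + f x \<in> A})) \<le> (\<Sum>g\<in>(UNIV::'b set). \<delta> * card X)"
      using that by (intro sum_mono) (meson not_less)
    then have "real (card X * card A) \<le> real CARD('b) * (\<delta> * card X)"
      unfolding eq by simp
    then have "real (card A) \<le> \<delta> * real CARD('b)"
      using assms(1,2) by (simp add: card_gt_0_iff algebra_simps)
    then show False using assms(3) by (simp add: field_simps)
  qed
qed

section \<open>Sumsets of density about one half\<close>

theorem theorem1p2: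
  fixes A :: "(bit ^ 'n) set" and \<epsilon> :: real
  assumes "\<epsilon> \<in> {0 <.. 1 / (2 ^ 9 * sqrt (real CARD('n)))}"
    and "real (card A) / real (card (UNIV :: (bit ^ 'n) set)) > 1 / 2 - \<epsilon>"
  shows "\<exists>V :: (bit ^ 'n) set. vec.subspace V \<and>
           vec.dim V + 1 = vec.dim (UNIV :: (bit ^ 'n) set) \<and> V \<subseteq> A + A"
proof -
  define S where "S = - (A + A)"
  have shift: "a + s \<notin> A" if "s \<in> S" "a \<in> A" for a s
  proof
    assume "a + s \<in> A"
    then have "a + (a + s) \<in> A + A" using that by (intro set_plus_intro)
    then show False using that by (simp add: S_def)
  qed
  \<comment> \<open>If \<open>S\<close> is empty, any nonzero \<open>s\<close> serves: then
    \<open>D\<close> is empty and its span is zero, so \<open>s\<close> lies outside it and the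
    hyperplane case applies.\<close>
  obtain s where s: "s \<in> S \<or> S = {} \<and> s \<noteq> 0"
    using one_neq_zero[where 'a = "bit ^ 'n"] by blast
  define D where "D = (\<lambda>x. s + x) ` S"
  show ?thesis
  proof (cases "s \<in> vec.span D")
    case False
    then obtain V where V: "vec.subspace V" "vec.dim V + 1 = vec.dim (UNIV :: (bit ^ 'n) set)"
        "vec.span D \<subseteq> V" "s \<notin> V"
      using hyperplane_avoiding_vector[of "vec.span D" s] by auto
    \<comment> \<open>For \<open>x\<close> in both \<open>V\<close> and \<open>S\<close>, the vector
      \<open>s = (s + x) + x\<close> would lie in \<open>V\<close>.\<close>
    have "x \<notin> S" if "x \<in> V" for x
    proof
      assume "x \<in> S"
      then have "s + x \<in> V" using V(3) vec.span_base[of "s + x" D] by (auto simp: D_def)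
      then have "s + x + x \<in> V" using that V(1) vec.subspace_add by blast
      then show False using V(4) by (simp add: add.assoc)
    qed
    then show ?thesis using V by (auto simp: S_def)
  next
    case True
    then obtain B where B: "B \<subseteq> D" "finite B" "card B \<le> CARD('n)" "s = \<Sum>B"
      by (rule bit_vec_span_imp_sum)
    have "s \<in> S" using s B by (auto simp: D_def)
    have sB: "s + b \<in> S" if "b \<in> B" for b using that B(1) by (auto simp: D_def)
    obtain g where "(1 / 2 - \<epsilon>) * card (Pow B) < card {y \<in> Pow B. g + \<Sum>y \<in> A}"
      using exists_dense_translate[of "Pow B" "1 / 2 - \<epsilon>" A "\<lambda>y. \<Sum>y"] B assms(2) by auto
    define C where "C = {y. g + \<Sum>y \<in> A}"
    define F where "F = {y. g + s + \<Sum>y \<in> A}"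
    define N where "N = (2::real) ^ card B"
    define \<mu> where "\<mu> = card (Pow B \<inter> C) / N"
    have "N > 0" by (simp add: N_def)
    have "\<mu> > 1 / 2 - \<epsilon>"
    proof -
      have "{y \<in> Pow B. g + \<Sum>y \<in> A} = Pow B \<inter> C" by (auto simp: C_def)
      then have "(1 / 2 - \<epsilon>) * N < card (Pow B \<inter> C)"
        using \<open>(1 / 2 - \<epsilon>) * card (Pow B) < _\<close> B(2) by (simp add: N_def card_Pow)
      then show ?thesis using \<open>N > 0\<close> by (simp add: \<mu>_def field_simps)
    qed
    have compl: "\<Sum>(B - y) = s + \<Sum>y" if "y \<subseteq> B" for y
    proof -
      have "s = \<Sum>(B - y) + \<Sum>y"
        using sum.subset_diff[OF that B(2), of "\<lambda>x. x"] B(4) by simp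
      then show ?thesis by (simp add: add.assoc)
    qed
    \<comment> \<open>Complementation in \<open>B\<close> is an involution that adds
      \<open>s\<close> to the subset sum, so it exchanges \<open>C\<close> and
      \<open>F\<close>.\<close>
    have "bij_betw (\<lambda>y. B - y) (Pow B \<inter> C) (Pow B \<inter> F)"
      by (rule bij_betw_byWitness[where f' = "\<lambda>y. B - y"])
        (auto simp: C_def F_def compl add.assoc double_diff)
    then have F: "card (Pow B \<inter> F) / N = \<mu>"
      by (simp add: \<mu>_def bij_betw_same_card)
    have "C \<inter> F = {}"
      using shift[OF \<open>s \<in> S\<close>, of "g + \<Sum>y" for y] by (auto simp: C_def F_def add_ac)
    moreover have "sym_diff y {b} \<notin> F" if "y \<in> Pow B \<inter> C" "b \<in> B" for y b
    proof -
      have "finite y" using that B(2) finite_subset by auto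
      then have "g + s + \<Sum>(sym_diff y {b}) = g + \<Sum>y + (s + b)"
        by (simp only: bit_vec_sum_sym_diff add_ac)
      moreover have "g + \<Sum>y + (s + b) \<notin> A"
        using shift[OF sB[OF that(2)], of "g + \<Sum>y"] that(1) by (simp add: C_def)
      ultimately show ?thesis unfolding F_def by (simp only: mem_Collect_eq not_False_eq_True)
    qed
    ultimately have iso: "\<mu> * (1 - \<mu>) \<le> sqrt (card B) * (1 - \<mu> - \<mu>)"
      using vertex_boundary_bound[of B C F] B(2) F by (simp add: \<mu>_def N_def)
    \<comment> \<open>As \<open>sqrt n \<ge> 1\<close>, the bound on \<open>\<epsilon>\<close> gives
      \<open>\<epsilon> \<le> 1 / 2 ^ 9\<close>, hence \<open>\<mu> \<ge> 1 / 4\<close>.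
      Disjointness of the equally large \<open>C\<close> and \<open>F\<close> gives
      \<open>\<mu> \<le> 1 / 2\<close>.\<close>
    have n: "1 \<le> sqrt (real CARD('n))" by (simp add: Suc_leI)
    have \<epsilon>: "\<epsilon> * sqrt (real CARD('n)) \<le> 1 / 2 ^ 9" "0 < \<epsilon>"
      using assms(1) n by (auto simp: field_simps)
    then have "\<epsilon> * 1 \<le> 1 / 2 ^ 9" using n by (meson less_imp_le mult_left_mono order_trans)
    then have "1 / 4 \<le> \<mu>" using \<open>\<mu> > 1 / 2 - \<epsilon>\<close> by simp
    have "0 \<le> 1 - \<mu> - \<mu>"
    proof -
      have "card (Pow B \<inter> C) + card (Pow B \<inter> F) = card (Pow B \<inter> C \<union> Pow B \<inter> F)"
        using \<open>C \<inter> F = {}\<close> B(2) by (intro card_Un_disjoint[symmetric]) auto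
      also have "\<dots> \<le> card (Pow B)" using B(2) by (intro card_mono) auto
      finally have "real (card (Pow B \<inter> C)) + card (Pow B \<inter> F) \<le> N"
        using B(2) by (simp add: card_Pow N_def flip: of_nat_add of_nat_le_iff)
      then have "card (Pow B \<inter> C) / N + card (Pow B \<inter> F) / N \<le> 1"
        using \<open>N > 0\<close> by (simp flip: add_divide_distrib)
      then show ?thesis unfolding F \<mu>_def[symmetric] by simp
    qed
    \<comment> \<open>The contradiction is \<open>1 / 8 \<le> 2 / 2 ^ 9\<close>: the boundary
      density \<open>1 - 2 * \<mu>\<close> is below \<open>2 * \<epsilon>\<close>, and
      \<open>card B\<close> is at most \<open>n\<close>.\<close>
    then have "1 / 4 * (1 / 2) \<le> \<mu> * (1 - \<mu>)"
      using \<open>1 / 4 \<le> \<mu>\<close> by (intro mult_mono) auto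
    also note iso
    also have "sqrt (card B) * (1 - \<mu> - \<mu>) \<le> sqrt (real CARD('n)) * (2 * \<epsilon>)"
      using B(3) \<open>0 \<le> 1 - \<mu> - \<mu>\<close> \<open>\<mu> > 1 / 2 - \<epsilon>\<close> by (intro mult_mono) auto
    also have "\<dots> \<le> 2 / 2 ^ 9" using \<epsilon>(1) by (simp add: mult.commute)
    finally show ?thesis by simp
  qed
qed

end
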